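(* Let $k\ge 2$ be an integer and let $F$ be an acyclic graph with $n$ vertices, where $n\ge k$. Then $\alpha_k(F)\ge \frac{k-1}{k}\,n$. Moreover, equality $\alpha_k(F)=\frac{k-1}{k}\,n$ holds if and only if each connected component $T$ of $F$ satisfies $k\mid |V_T|$ and $T\in R^k_{|V_T|/k}$.
   Context: All graphs are finite and simple; a graph is acyclic if it contains no cycles. For a graph $G$ with vertex set $V_G$ and an integer $k\ge 2$, a set $S\subseteq V_G$ is a generalized $k$-independent set if the induced subgraph $G[S]$ contains no tree on $k$ vertices as a (not necessarily induced) subgraph. The generalized $k$-independence number $\alpha_k(G)$ is the maximum size of a generalized $k$-independent set of $G$. For integers $k\ge 2$ and $i\ge 1$, the family $R_i^k$ of trees on $ik$ vertices is defined recursively: $R_1^k$ is the set of all trees on $k$ vertices; for $i\ge 2$, a tree $T$ lies in $R_i^k$ if there exist $T'\in R_{i-1}^k$ and a tree $T''$ on $k$ vertices such that $T$ is obtained from the disjoint union $T'\cup T''$ by adding a single edge joining a vertex of $T'$ to a vertex of $T''$. *)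

theory Defs
  imports Complex_Main "Graph_Theory.Digraph_Component"
begin

text \<open>
  Finite simple graphs are represented by \<^locale>\<open>pair_graph\<close>: finite, loop-free digraphs whose arc
  relation is symmetric, so that an undirected edge \<open>uv\<close> is the pair of arcs \<open>(u,v)\<close>, \<open>(v,u)\<close>.

  \<^const>\<open>forest\<close> and \<^const>\<open>tree\<close> are digraph notions: they count the closed walk \<open>u, v, u\<close>
  along one undirected edge as a cycle, so a symmetric digraph is a \<^const>\<open>forest\<close> only if it has no
  edges at all. Cycles of an undirected graph are the digraph cycles of length at least 3.
\<close>

definition acyclic_graph :: "'a pair_pre_digraph \<Rightarrow> bool" where
  "acyclic_graph G \<longleftrightarrow> \<not> (\<exists>p. pre_digraph.cycle (with_proj G) p \<and> 3 \<le> length p)"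

definition tree_graph :: "'a pair_pre_digraph \<Rightarrow> bool" where
  "tree_graph T \<longleftrightarrow> pair_graph T \<and> connected (with_proj T) \<and> acyclic_graph T"

text \<open>
  A maximal connected subgraph inherits the (fixed) tail and head functions of \<open>with_proj G\<close>, hence is
  itself of the form \<open>with_proj T\<close>; no component is lost by ranging over pair digraphs.
\<close>

definition graph_components :: "'a pair_pre_digraph \<Rightarrow> 'a pair_pre_digraph set" where
  "graph_components G = {T. pre_digraph.max_subgraph (with_proj G) connected (with_proj T)}"

definition gen_independent :: "nat \<Rightarrow> 'a pair_pre_digraph \<Rightarrow> 'a set \<Rightarrow> bool" where
  "gen_independent k G S \<longleftrightarrow> S \<subseteq> pverts G \<and>
     \<not> (\<exists>T. tree_graph T \<and> card (pverts T) = k \<and> subgraph (with_proj T) (with_proj G \<restriction> S))"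

definition gen_independence_number :: "nat \<Rightarrow> 'a pair_pre_digraph \<Rightarrow> nat" where
  "gen_independence_number k G = Max {card S | S. gen_independent k G S}"

definition join_by_edge ::
  "'a pair_pre_digraph \<Rightarrow> 'a pair_pre_digraph \<Rightarrow> 'a \<Rightarrow> 'a \<Rightarrow> 'a pair_pre_digraph" where
  "join_by_edge G H u v =
     \<lparr> pverts = pverts G \<union> pverts H, parcs = parcs G \<union> parcs H \<union> {(u, v), (v, u)} \<rparr>"

text \<open>
  The members of \<open>R_family k i\<close> are concrete trees on vertices of type \<open>'a\<close>. The disjoint union is
  a union of trees with disjoint vertex sets; as both parts are subgraphs of the resulting tree, this
  agrees with the construction up to isomorphism. The index starts at 1; the value at 0 is a dummy.
\<close>

fun R_family :: "nat \<Rightarrow> nat \<Rightarrow> 'a pair_pre_digraph set" where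
  "R_family k 0 = {}"
| "R_family k (Suc 0) = {T. tree_graph T \<and> card (pverts T) = k}"
| "R_family k (Suc (Suc i)) =
     {T. tree_graph T \<and>
         (\<exists>T' T'' u v. T' \<in> R_family k (Suc i) \<and>
            tree_graph T'' \<and> card (pverts T'') = k \<and>
            pverts T' \<inter> pverts T'' = {} \<and>
            u \<in> pverts T' \<and> v \<in> pverts T'' \<and>
            T = join_by_edge T' T'' u v)}"

end

theory Submission
  imports Defs
begin

text \<open>
  The vertex set of a tree contained in a graph is connected, and in a forest every connected vertex
  set induces a tree. So in a forest \<open>F\<close> a set \<open>S\<close> is generalized \<open>k\<close>-independent iff it
  contains no connected set of exactly \<open>k\<close> vertices (\<open>gen_independent_iff\<close>), and the complements of
  such sets are the transversals of the connected \<open>k\<close>-sets. Both claims are about the smallest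
  transversal: it has at most \<open>n / k\<close> vertices, and exactly \<open>n / k\<close> iff every component can be cut
  into connected pieces of \<open>k\<close> vertices each.

  For the upper bound on the transversal (\<open>exists_transversal\<close>) one looks at the branches of \<open>F\<close>:
  connected sets \<open>C\<close> of at least \<open>k\<close> vertices that at most one edge leaves. In a minimal branch
  the end \<open>v\<close> of that edge (any vertex, if there is none) meets all connected \<open>k\<close>-sets in \<open>C\<close>:
  a component of \<open>C - {v}\<close> with \<open>k\<close> or more vertices would be attached to \<open>v\<close> by a single edge,
  as there are no cycles, and thus be a smaller branch (\<open>exists_branch\<close>). So \<open>v\<close> goes into the transversal, the rest of \<open>C\<close> is
  settled, no connected \<open>k\<close>-set avoiding \<open>v\<close> crosses the boundary of \<open>C\<close>, and one recurses on the
  remaining vertices. Each chosen vertex pays for at least \<open>k\<close> deleted ones.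

  If the transversal so built has exactly \<open>n / k\<close> vertices, then every branch that was cut off had
  exactly \<open>k\<close> vertices. Undoing the deletions adds trees on \<open>k\<close> vertices one by one, each joined to
  the rest by at most one edge, which is the recursion that defines the family \<open>R\<close>. Conversely,
  a tree in the \<open>i\<close>-th level of the family consists of \<open>i\<close> disjoint trees on \<open>k\<close> vertices,
  and an independent set misses a vertex of each (\<open>R_family_independent_bound\<close>); summing over the
  components gives the matching upper bound on the independence number.
\<close>

section \<open>Connected vertex sets of a relation\<close>

text \<open>
  Connectedness is expressed by cuts, since almost every use below asks for an edge leaving a part
  of a connected set. Only edges inside \<open>U\<close> count, so a fixed relation serves all induced subgraphs.
\<close>

definition connected_set :: "'a rel \<Rightarrow> 'a set \<Rightarrow> bool" where
  "connected_set E U \<longleftrightarrow> U \<noteq> {} \<and>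
     (\<forall>A. U \<inter> A \<noteq> {} \<and> U - A \<noteq> {} \<longrightarrow> (\<exists>a \<in> U \<inter> A. \<exists>b \<in> U - A. (a, b) \<in> E))"

lemma connected_set_crossing:
  "connected_set E U \<Longrightarrow> U \<inter> A \<noteq> {} \<Longrightarrow> U - A \<noteq> {} \<Longrightarrow> \<exists>a \<in> U \<inter> A. \<exists>b \<in> U - A. (a, b) \<in> E"
  by (simp add: connected_set_def)

lemma connected_set_mono: "connected_set E U \<Longrightarrow> E \<inter> U \<times> U \<subseteq> E' \<Longrightarrow> connected_set E' U"
  unfolding connected_set_def by blast

text \<open>
  The link to reachability: the vertices reachable from \<open>x\<close> form a part that no edge leaves, and
  conversely a path from inside a part to its outside must step over the boundary somewhere.
\<close>

lemma connected_set_iff_rtrancl: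
  "connected_set E U \<longleftrightarrow> U \<noteq> {} \<and> (\<forall>x\<in>U. \<forall>y\<in>U. (x, y) \<in> (E \<inter> U \<times> U)\<^sup>*)"
proof (intro iffI conjI ballI)
  assume c: "connected_set E U"
  then show "U \<noteq> {}" by (simp add: connected_set_def)
  fix x y assume xy: "x \<in> U" "y \<in> U"
  show "(x, y) \<in> (E \<inter> U \<times> U)\<^sup>*"
  proof (rule ccontr)
    let ?A = "{z. (x, z) \<in> (E \<inter> U \<times> U)\<^sup>*}"
    assume "(x, y) \<notin> (E \<inter> U \<times> U)\<^sup>*"
    then have "U \<inter> ?A \<noteq> {}" "U - ?A \<noteq> {}" using xy by auto
    with c obtain a b where "a \<in> U" "a \<in> ?A" "b \<in> U" "b \<notin> ?A" "(a, b) \<in> E"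
      by (blast dest: connected_set_crossing)
    then show False by (auto dest: rtrancl_into_rtrancl)
  qed
next
  assume r: "U \<noteq> {} \<and> (\<forall>x\<in>U. \<forall>y\<in>U. (x, y) \<in> (E \<inter> U \<times> U)\<^sup>*)"
  show "connected_set E U"
    unfolding connected_set_def
  proof (intro conjI allI impI)
    show "U \<noteq> {}" using r by blast
    fix A assume "U \<inter> A \<noteq> {} \<and> U - A \<noteq> {}"
    then obtain x y where xy: "x \<in> U" "x \<in> A" "y \<in> U" "y \<notin> A" by blast
    show "\<exists>a \<in> U \<inter> A. \<exists>b \<in> U - A. (a, b) \<in> E"
    proof (rule ccontr)
      assume n: "\<not> ?thesis"
      have "(x, y) \<in> (E \<inter> U \<times> U)\<^sup>*" using r xy by blast
      then have "y \<in> A" by (induction) (use xy n in auto)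
      with xy show False by simp
    qed
  qed
qed

lemma connected_set_singleton: "connected_set E {x}"
  by (auto simp: connected_set_def)

lemma connected_set_insert:
  assumes "connected_set E U" "a \<in> U" "(a, b) \<in> E" "(b, a) \<in> E"
  shows "connected_set E (insert b U)"
  unfolding connected_set_def
proof (intro conjI allI impI)
  fix A assume A: "insert b U \<inter> A \<noteq> {} \<and> insert b U - A \<noteq> {}"
  show "\<exists>x \<in> insert b U \<inter> A. \<exists>y \<in> insert b U - A. (x, y) \<in> E"
  proof (cases "U \<inter> A \<noteq> {} \<and> U - A \<noteq> {}")
    case True
    then show ?thesis using connected_set_crossing[OF assms(1), of A] by blast
  next
    case False
    then show ?thesis using A assms by blast
  qed
qed auto

definition component :: "'a rel \<Rightarrow> 'a set \<Rightarrow> 'a set \<Rightarrow> bool" where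
  "component E V U \<longleftrightarrow> connected_set E U \<and> U \<subseteq> V \<and> (\<forall>a \<in> U. \<forall>b \<in> V - U. (a, b) \<notin> E)"

text \<open>
  Otherwise a connected set would contain an edge across the boundary of the component. This makes
  components pairwise disjoint.
\<close>

lemma component_absorbs:
  assumes "component E V U" "connected_set E W" "W \<subseteq> V" "W \<inter> U \<noteq> {}"
  shows "W \<subseteq> U"
proof (rule ccontr)
  assume "\<not> W \<subseteq> U"
  then have "W - U \<noteq> {}" by blast
  with assms(2,4) obtain a b where "a \<in> W" "a \<in> U" "b \<in> W" "b \<notin> U" "(a, b) \<in> E"
    by (blast dest: connected_set_crossing)
  then show False using assms(1,3) by (auto simp: component_def)
qed

lemma components_disjoint:
  assumes "component E V U" "component E V W" "U \<noteq> W"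
  shows "U \<inter> W = {}"
proof (rule ccontr)
  assume meet: "U \<inter> W \<noteq> {}"
  have "connected_set E U" "connected_set E W" "U \<subseteq> V" "W \<subseteq> V"
    using assms(1,2) by (simp_all add: component_def)
  then have "W \<subseteq> U" "U \<subseteq> W"
    using meet component_absorbs[OF assms(1)] component_absorbs[OF assms(2)]
    by (simp_all add: Int_commute)
  with assms(3) show False by simp
qed

text \<open>
  A maximal connected superset is a component, as an edge leaving it would let it grow.
\<close>

lemma connected_set_in_component:
  assumes "sym E" "finite V" "connected_set E W" "W \<subseteq> V"
  obtains U where "component E V U" "W \<subseteq> U"
proof -
  let ?K = "{U. connected_set E U \<and> U \<subseteq> V}"
  have fin: "finite ?K" by (rule finite_subset[of _ "Pow V"]) (use assms in auto)
  have W: "W \<in> ?K" using assms by simp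
  obtain U where U: "U \<in> ?K" "W \<subseteq> U" and max: "\<And>U'. U' \<in> ?K \<Longrightarrow> U \<subseteq> U' \<Longrightarrow> U = U'"
    using finite_has_maximal2[OF fin W] by auto
  have "(a, b) \<notin> E" if "a \<in> U" "b \<in> V - U" for a b
  proof
    assume "(a, b) \<in> E"
    moreover from this have "(b, a) \<in> E" using assms(1) by (rule symD[rotated])
    ultimately have "connected_set E (insert b U)"
      using U that by (blast intro: connected_set_insert)
    then have "U = insert b U" using that U by (intro max) auto
    then show False using that by blast
  qed
  then have "component E V U" using U by (auto simp: component_def)
  with U(2) that show thesis by blast
qed

lemma card_eq_sum_components:
  assumes "sym E" "finite V" "S \<subseteq> V"
  shows "card S = (\<Sum>U | component E V U. card (S \<inter> U))"
proof -
  let ?K = "{U. component E V U}"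
  have "?K \<subseteq> Pow V" by (auto simp: component_def)
  then have fin: "finite ?K" using assms(2) by (simp add: finite_subset)
  have "S = (\<Union>U\<in>?K. S \<inter> U)"
  proof -
    have "\<exists>U. component E V U \<and> x \<in> U" if "x \<in> S" for x
    proof -
      have "{x} \<subseteq> V" using that assms(3) by blast
      with assms(1,2) connected_set_singleton obtain U where "component E V U" "{x} \<subseteq> U"
        by (rule connected_set_in_component)
      then show ?thesis by blast
    qed
    then show ?thesis by blast
  qed
  also have "card \<dots> = (\<Sum>U\<in>?K. card (S \<inter> U))"
  proof (rule card_UN_disjoint[OF fin])
    show "\<forall>U\<in>?K. finite (S \<inter> U)" using assms by (auto intro: finite_subset)
    show "\<forall>U\<in>?K. \<forall>W\<in>?K. U \<noteq> W \<longrightarrow> S \<inter> U \<inter> (S \<inter> W) = {}"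
      using components_disjoint[of E V] by fastforce
  qed
  finally show ?thesis .
qed

section \<open>Branches of a forest\<close>

text \<open>
  The consequence of acyclicity that the combinatorial argument runs on: a connected set and a
  vertex outside it are joined by at most one edge. It passes to all induced subgraphs because
  \<^const>\<open>connected_set\<close> does, so the relation stays fixed while the vertex set shrinks.
\<close>

locale forest_relation =
  fixes E :: "'a rel"
  assumes sym: "sym E"
    and unique_attachment:
      "\<lbrakk>connected_set E D; v \<notin> D; x \<in> D; y \<in> D; (v, x) \<in> E; (v, y) \<in> E\<rbrakk> \<Longrightarrow> x = y"
begin

text \<open>
  The single edge that may leave the branch \<open>C\<close> within \<open>V\<close> is \<open>(v, w)\<close>; if there is none,
  \<open>v\<close> and \<open>w\<close> are arbitrary. Among all branches, which include the component of \<open>W\<close>, \<open>C\<close> is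
  taken minimal. A component \<open>B\<close> of \<open>C - {v}\<close> with at least \<open>k\<close> vertices would then be a smaller
  branch: it is cut off from \<open>V - C\<close>, since only \<open>v\<close> has a neighbour there, and it has at most one
  edge to \<open>v\<close>.
\<close>

lemma exists_branch:
  assumes "finite V" "connected_set E W" "W \<subseteq> V" "k \<le> card W"
  obtains C v w where "connected_set E C" "C \<subseteq> V" "k \<le> card C" "v \<in> C"
    "E \<inter> C \<times> (V - C) \<subseteq> {(v, w)}"
    "\<And>D. connected_set E D \<Longrightarrow> D \<subseteq> C - {v} \<Longrightarrow> card D < k"
proof -
  define branch where "branch C \<longleftrightarrow> connected_set E C \<and> C \<subseteq> V \<and> k \<le> card C \<and>
    (\<exists>v\<in>C. \<exists>w. E \<inter> C \<times> (V - C) \<subseteq> {(v, w)})" for C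
  obtain U where U: "component E V U" "W \<subseteq> U"
    using connected_set_in_component[OF sym assms(1-3)] .
  have "finite U" using U assms(1) by (auto simp: component_def intro: finite_subset)
  then have "k \<le> card U" using card_mono[OF _ U(2)] assms(4) by linarith
  have "E \<inter> U \<times> (V - U) = {}" "U \<noteq> {}" "connected_set E U" "U \<subseteq> V"
    using U(1) by (auto simp: component_def connected_set_def)
  then have "branch U" using \<open>k \<le> card U\<close> by (auto simp: branch_def)
  then have ne: "{C. branch C} \<noteq> {}" by blast
  have "{C. branch C} \<subseteq> Pow V" by (auto simp: branch_def)
  then have fin: "finite {C. branch C}" using assms(1) by (simp add: finite_subset)
  obtain C where C: "branch C" and min: "\<And>C'. branch C' \<Longrightarrow> C' \<subseteq> C \<Longrightarrow> C = C'"
    using finite_has_minimal[OF fin ne] by auto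
  then obtain v w where vw: "v \<in> C" "E \<inter> C \<times> (V - C) \<subseteq> {(v, w)}" by (auto simp: branch_def)
  have small: "card D < k" if D: "connected_set E D" "D \<subseteq> C - {v}" for D
  proof (rule ccontr)
    assume "\<not> card D < k"
    have finC: "finite (C - {v})"
      using C assms(1) by (auto simp: branch_def intro: finite_subset)
    obtain B where B: "component E (C - {v}) B" "D \<subseteq> B"
      using connected_set_in_component[OF sym finC D] .
    then have BC: "B \<subseteq> C - {v}" "connected_set E B" by (auto simp: component_def)
    have "finite B" using BC finC by (blast intro: finite_subset)
    then have "k \<le> card B"
      using card_mono[OF _ B(2)] \<open>\<not> card D < k\<close> by linarith
    have to_v: "b = v" if "(a, b) \<in> E" "a \<in> B" "b \<in> V - B" for a b
      using that BC B(1) vw(2) unfolding component_def by blast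
    have "\<exists>x\<in>B. E \<inter> B \<times> (V - B) \<subseteq> {(x, v)}"
    proof (cases "E \<inter> B \<times> (V - B) = {}")
      case True
      then show ?thesis using BC(2) unfolding connected_set_def by blast
    next
      case False
      then obtain x where x: "x \<in> B" "(x, v) \<in> E" using to_v by blast
      have "a = x \<and> b = v" if "(a, b) \<in> E" "a \<in> B" "b \<in> V - B" for a b
        using unique_attachment[OF BC(2), of v a x] that to_v[OF that] x BC(1) symD[OF sym] by blast
      then show ?thesis using x by blast
    qed
    then have "branch B" using BC C \<open>k \<le> card B\<close> by (auto simp: branch_def)
    then have "C = B" using BC by (intro min) auto
    then show False using BC vw by blast
  qed
  show thesis using that[of C v w] C vw small by (auto simp: branch_def)
qed

text \<open>
  Cutting a branch off its component leaves the rest connected. Of the two sides of a cut of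
  \<open>U - C\<close>, one does not contain \<open>w\<close>. That side has an edge to its complement in \<open>U\<close>, and this
  edge cannot end in \<open>C\<close>, whose only outer neighbour is \<open>w\<close>.
\<close>

lemma component_Diff_branch:
  assumes U: "component E V U" and "C \<subset> U" and C: "E \<inter> C \<times> (V - C) \<subseteq> {(v, w)}"
  shows "component E (V - C) (U - C)"
proof -
  have conn: "connected_set E U" and UV: "U \<subseteq> V" using U by (auto simp: component_def)
  have out: "\<exists>a\<in>B. \<exists>b\<in>U - C - B. (a, b) \<in> E" if B: "B \<subseteq> U - C" "B \<noteq> {}" "w \<notin> B" "U - B \<noteq> {}" for B
  proof -
    obtain a b where "a \<in> U" "a \<in> B" "b \<in> U" "b \<notin> B" "(a, b) \<in> E"
      using connected_set_crossing[OF conn, of B] B by blast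
    moreover from this have "(b, a) \<in> E" using sym by (blast dest: symD)
    ultimately show ?thesis using C B UV by blast
  qed
  have "connected_set E (U - C)"
    unfolding connected_set_def
  proof (intro conjI allI impI)
    show "U - C \<noteq> {}" using \<open>C \<subset> U\<close> by blast
    fix A assume A: "(U - C) \<inter> A \<noteq> {} \<and> U - C - A \<noteq> {}"
    show "\<exists>a\<in>(U - C) \<inter> A. \<exists>b\<in>U - C - A. (a, b) \<in> E"
    proof (cases "w \<in> A")
      case True
      then obtain a b where "a \<in> U - C - A" "b \<in> U - C - (U - C - A)" "(a, b) \<in> E"
        using out[of "U - C - A"] A by blast
      then show ?thesis using sym by (blast dest: symD)
    next
      case False
      then show ?thesis using out[of "(U - C) \<inter> A"] A by blast
    qed
  qed
  then show ?thesis using U by (auto simp: component_def)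
qed

end

section \<open>Induced subgraphs of a graph\<close>

definition induced :: "'a pair_pre_digraph \<Rightarrow> 'a set \<Rightarrow> 'a pair_pre_digraph" where
  "induced G U = \<lparr> pverts = U, parcs = parcs G \<inter> U \<times> U \<rparr>"

lemma induced_simps [simp]:
  "pverts (induced G U) = U" "parcs (induced G U) = parcs G \<inter> U \<times> U"
  by (simp_all add: induced_def)

lemma sym_parcs: "pair_graph G \<Longrightarrow> sym (parcs G)"
  using pair_sym_digraph.pair_sym_arcs[of G]
  by (simp add: pair_graph_def pair_pseudo_graph_def symmetric_def)

lemma wf_with_proj: "pair_graph G \<Longrightarrow> wf_digraph (with_proj G)"
  by (simp add: wf_digraph_wp_iff pair_graph_def pair_digraph_def pair_fin_digraph_def)

lemma finite_pverts: "pair_graph G \<Longrightarrow> finite (pverts G)"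
  by (simp add: pair_graph_def pair_digraph_def pair_fin_digraph.pair_finite_verts)

lemma pair_graph_induced:
  assumes "pair_graph G" "U \<subseteq> pverts G"
  shows "pair_graph (induced G U)"
proof -
  interpret pair_graph G by fact
  show ?thesis
    using assms(2) pair_finite_verts pair_finite_arcs no_loops' sym_parcs[OF assms(1)]
    by unfold_locales (auto simp: symmetric_def sym_def intro: finite_subset)
qed

lemma subgraph_induced:
  assumes "pair_graph G" "U \<subseteq> pverts G"
  shows "subgraph (with_proj (induced G U)) (with_proj G)"
  using assms wf_with_proj[OF assms(1)] wf_with_proj[OF pair_graph_induced[OF assms]]
  by (auto intro!: subgraphI)

text \<open>
  \<^const>\<open>connected\<close> of an arbitrary digraph refers to its symmetric closure; a subgraph of a symmetric
  graph need not be symmetric, so the closure is kept until the surrounding graph absorbs it.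
\<close>

lemma connected_iff_connected_set:
  assumes "wf_digraph H"
  shows "connected H \<longleftrightarrow> connected_set (parcs (mk_symmetric H)) (verts H)"
proof -
  interpret S: pair_wf_digraph "mk_symmetric H" using wf_digraph.wellformed_mk_symmetric[OF assms] .
  have "parcs (mk_symmetric H) \<inter> verts H \<times> verts H = parcs (mk_symmetric H)"
    using S.in_arcsD1 S.in_arcsD2 by auto
  then show ?thesis
    by (auto simp: connected_def strongly_connected_def connected_set_iff_rtrancl S.reachable_conv)
qed

lemma connected_subgraph_imp_connected_set:
  assumes "pair_graph G" "subgraph H (with_proj G)" "connected H"
  shows "connected_set (parcs G) (verts H)"
proof -
  have "parcs (mk_symmetric H) \<subseteq> parcs G"
    using assms(2) sym_parcs[OF assms(1)]
    by (auto simp: parcs_mk_symmetric subgraph_def compatible_def dest: symD)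
  moreover have "connected_set (parcs (mk_symmetric H)) (verts H)"
    using assms by (subst connected_iff_connected_set[symmetric]) auto
  ultimately show ?thesis by (blast intro: connected_set_mono)
qed

lemma connected_induced:
  assumes "pair_graph G" "U \<subseteq> pverts G" "connected_set (parcs G) U"
  shows "connected (with_proj (induced G U))"
  using assms(3) wf_with_proj[OF pair_graph_induced[OF assms(1,2)]]
  by (auto simp: connected_iff_connected_set parcs_mk_symmetric elim!: connected_set_mono)

lemma tree_graph_induced:
  assumes "pair_graph G" "acyclic_graph G" "U \<subseteq> pverts G" "connected_set (parcs G) U"
  shows "tree_graph (induced G U)"
  using assms pair_graph_induced connected_induced
    wf_digraph.subgraph_cycle[OF wf_with_proj[OF assms(1)] subgraph_induced[OF assms(1,3)]]
  unfolding tree_graph_def acyclic_graph_def by blast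

lemma tree_graph_connected_set:
  assumes "tree_graph T"
  shows "connected_set (parcs T) (pverts T)"
  using assms connected_subgraph_imp_connected_set[of T "with_proj T"]
    wf_digraph.subgraph_refl[OF wf_with_proj, of T]
  by (simp add: tree_graph_def)

text \<open>
  Two edges from \<open>v\<close> to distinct vertices \<open>x\<close>, \<open>y\<close> of a connected set \<open>D\<close> close up a simple path
  from \<open>x\<close> to \<open>y\<close> inside \<open>D\<close> to a cycle. The path has at least one arc, so the cycle has at least
  three and is a cycle of the undirected graph.
\<close>

lemma forest_relation_parcs:
  assumes G: "pair_graph G" "acyclic_graph G"
  shows "forest_relation (parcs G)"
proof
  show "sym (parcs G)" using G(1) by (rule sym_parcs)
  interpret G: pair_graph G by fact
  fix D v x y
  assume D: "connected_set (parcs G) D" "v \<notin> D" "x \<in> D" "y \<in> D" "(v, x) \<in> parcs G" "(v, y) \<in> parcs G"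
  show "x = y"
  proof (rule ccontr)
    assume "x \<noteq> y"
    \<comment> \<open>D is not a singleton, hence each of its vertices lies on an arc.\<close>
    have DV: "D \<subseteq> pverts G"
    proof
      fix z assume "z \<in> D"
      show "z \<in> pverts G"
      proof (cases "z = x")
        case True
        then show ?thesis using D G.in_arcsD2 by blast
      next
        case False
        then obtain b where "(z, b) \<in> parcs G"
          using connected_set_crossing[OF D(1), of "{z}"] D \<open>z \<in> D\<close> by blast
        then show ?thesis by (rule G.in_arcsD1)
      qed
    qed
    interpret H: pair_graph "induced G D" using pair_graph_induced[OF G(1) DV] .
    have "(x, y) \<in> (parcs (induced G D))\<^sup>*"
      using D by (simp add: connected_set_iff_rtrancl)
    then have "x \<rightarrow>\<^sup>*\<^bsub>with_proj (induced G D)\<^esub> y"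
      using D by (simp add: H.reachable_conv)
    then obtain p where p: "H.apath x p y" by (auto simp: H.reachable_apath)
    then have w: "H.awalk x p y" and dist: "distinct (pawalk_verts x p)"
      by (auto simp: H.apath_def)
    have vs: "set (pawalk_verts x p) \<subseteq> D"
      using iffD1[OF H.awalk_conv w] by simp
    have "p \<noteq> []" using w \<open>x \<noteq> y\<close> by (auto simp: H.awalk_def)
    have wG: "G.awalk x p y"
      using G.subgraph_awalk_imp_awalk[OF w subgraph_induced[OF G(1) DV]] .
    let ?c = "(v, x) # p @ [(y, v)]"
    have "G.awalk v ?c v"
      using wG D symD[OF sym_parcs[OF G(1)]] G.in_arcsD1 by (auto simp: G.awalk_simps)
    moreover have "pawalk_verts x (p @ [(y, v)]) = pawalk_verts x p @ [v]"
      using wG G.awalk_verts_append[of x p "[(y, v)]" v] D symD[OF sym_parcs[OF G(1)]] G.in_arcsD1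
      by (auto simp: G.awalk_simps)
    ultimately have "G.cycle ?c"
      using dist vs D by (auto simp: G.cycle_def)
    moreover have "3 \<le> length ?c" using \<open>p \<noteq> []\<close> by (cases p) auto
    ultimately show False using G(2) unfolding acyclic_graph_def by blast
  qed
qed

text \<open>
  A maximal connected subgraph is contained in the subgraph induced on the component of its
  vertices, hence equal to it. Conversely, a connected subgraph above an induced component can add
  no vertices, because components absorb connected sets, and no arcs, because all are present.
\<close>

lemma graph_components_eq:
  assumes G: "pair_graph G"
  shows "graph_components G = induced G ` {U. component (parcs G) (pverts G) U}"
proof (intro equalityI subsetI)
  fix T assume "T \<in> graph_components G"
  then have T: "subgraph (with_proj T) (with_proj G)" "connected (with_proj T)"
    and max: "\<And>H. subgraph (with_proj T) H \<Longrightarrow> subgraph H (with_proj G) \<Longrightarrow> connected H \<Longrightarrow> H = with_proj T"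
    by (auto simp: graph_components_def pre_digraph.max_subgraph_def)
  have "pverts T \<subseteq> pverts G" using T(1) by (auto simp: subgraph_def)
  with connected_set_in_component[OF sym_parcs[OF G] finite_pverts[OF G]
      connected_subgraph_imp_connected_set[OF G T]]
  obtain U where U: "component (parcs G) (pverts G) U" "pverts T \<subseteq> U"
    by auto
  have UG: "U \<subseteq> pverts G" using U by (simp add: component_def)
  have wfT: "pair_wf_digraph T" using T(1) by (simp add: subgraph_def wf_digraph_wp_iff)
  have "subgraph (with_proj T) (with_proj (induced G U))"
  proof (rule subgraphI)
    show "arcs (with_proj T) \<subseteq> arcs (with_proj (induced G U))"
      using T(1) U(2) pair_wf_digraph.wellformed'[OF wfT] by (auto simp: subgraph_def)
  qed (use U T(1) wf_with_proj[OF pair_graph_induced[OF G UG]] in \<open>auto simp: subgraph_def\<close>)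
  then have "with_proj (induced G U) = with_proj T"
    using U by (intro max subgraph_induced connected_induced G) (auto simp: component_def)
  then have "T = induced G U"
    by (auto simp: with_proj_def intro: pair_pre_digraph.equality)
  with U(1) show "T \<in> induced G ` {U. component (parcs G) (pverts G) U}" by blast
next
  fix T assume "T \<in> induced G ` {U. component (parcs G) (pverts G) U}"
  then obtain U where U: "component (parcs G) (pverts G) U" and T: "T = induced G U" by blast
  have UG: "U \<subseteq> pverts G" "connected_set (parcs G) U" using U by (auto simp: component_def)
  have "H = with_proj T"
    if H: "subgraph (with_proj T) H" "subgraph H (with_proj G)" "connected H" for H
  proof -
    have "U \<subseteq> verts H" "verts H \<subseteq> pverts G" "U \<noteq> {}"
      using H(1,2) UG(2) T by (auto simp: subgraph_def connected_set_def)
    with component_absorbs[OF U connected_subgraph_imp_connected_set[OF G H(2,3)]]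
    have v: "verts H = U" by blast
    have th: "tail H = fst" "head H = snd" using H(2) by (auto simp: subgraph_def compatible_def)
    have "arcs H = parcs G \<inter> U \<times> U"
    proof
      show "parcs G \<inter> U \<times> U \<subseteq> arcs H" using H(1) T by (auto simp: subgraph_def)
      show "arcs H \<subseteq> parcs G \<inter> U \<times> U"
        using H(2) v th wf_digraph.tail_in_verts[of H] wf_digraph.head_in_verts[of H]
        by (fastforce simp: subgraph_def)
    qed
    with v th T show ?thesis by (auto simp: with_proj_def intro: pre_digraph.equality)
  qed
  then show "T \<in> graph_components G"
    using subgraph_induced[OF G UG(1)] connected_induced[OF G UG] T
    by (auto simp: graph_components_def pre_digraph.max_subgraph_def)
qed

section \<open>Independence through connected sets\<close>

text \<open>
  Acyclicity turns a connected set into a tree without passing to a spanning tree.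
\<close>

lemma gen_independent_iff:
  assumes G: "pair_graph G" "acyclic_graph G"
  shows "gen_independent k G S \<longleftrightarrow>
    S \<subseteq> pverts G \<and> (\<forall>U \<subseteq> S. connected_set (parcs G) U \<longrightarrow> card U \<noteq> k)"
proof (cases "S \<subseteq> pverts G")
  case True
  have GS: "with_proj G \<restriction> S = with_proj (induced G S)"
    by (auto simp: with_proj_def induce_subgraph_def)
  have "(\<exists>T. tree_graph T \<and> card (pverts T) = k \<and> subgraph (with_proj T) (with_proj (induced G S)))
    \<longleftrightarrow> (\<exists>U \<subseteq> S. connected_set (parcs G) U \<and> card U = k)" (is "?L \<longleftrightarrow> ?R")
  proof
    assume ?L
    then obtain T where T: "tree_graph T" "card (pverts T) = k"
      "subgraph (with_proj T) (with_proj (induced G S))" by blast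
    then have "connected_set (parcs G) (pverts T)"
      by (intro connected_set_mono[OF tree_graph_connected_set]) (auto simp: subgraph_def)
    then show ?R using T by (auto simp: subgraph_def)
  next
    assume ?R
    then obtain U where U: "U \<subseteq> S" "connected_set (parcs G) U" "card U = k" by blast
    have UG: "U \<subseteq> pverts G" using U True by blast
    have "subgraph (with_proj (induced G U)) (with_proj (induced G S))"
      using U(1) wf_with_proj[OF pair_graph_induced[OF G(1) UG]]
        wf_with_proj[OF pair_graph_induced[OF G(1) True]]
      by (auto intro!: subgraphI)
    then show ?L using tree_graph_induced[OF G UG U(2)] U(3) by (auto intro: exI[of _ "induced G U"])
  qed
  then show ?thesis using True by (auto simp: gen_independent_def GS)
qed (simp add: gen_independent_def)

lemma finite_gen_independent_cards:
  assumes "pair_graph G"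
  shows "finite {card S | S. gen_independent k G S}"
proof -
  have "{card S | S. gen_independent k G S} \<subseteq> card ` Pow (pverts G)"
    by (auto simp: gen_independent_def)
  then show ?thesis by (rule finite_subset) (simp add: finite_pverts[OF assms])
qed

lemma gen_independence_number_ge:
  "pair_graph G \<Longrightarrow> gen_independent k G S \<Longrightarrow> card S \<le> gen_independence_number k G"
  unfolding gen_independence_number_def
  by (intro Max_ge finite_gen_independent_cards) auto

lemma gen_independence_number_attained:
  assumes "pair_graph G" "gen_independent k G S"
  obtains M where "gen_independent k G M" "gen_independence_number k G = card M"
proof -
  have "gen_independence_number k G \<in> {card S | S. gen_independent k G S}"
    unfolding gen_independence_number_def
    by (intro Max_in finite_gen_independent_cards) (use assms in auto)
  then show thesis using that by auto
qed

section \<open>A small transversal of the trees on k vertices\<close>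

lemma R_family_join:
  assumes "T' \<in> R_family k i" "i > 0" "tree_graph T''" "card (pverts T'') = k"
    "pverts T' \<inter> pverts T'' = {}" "u \<in> pverts T'" "v \<in> pverts T''"
    "tree_graph (join_by_edge T' T'' u v)"
  shows "join_by_edge T' T'' u v \<in> R_family k (Suc i)"
proof -
  obtain j where "i = Suc j" using assms(2) by (cases i) auto
  then show ?thesis using assms by auto
qed

text \<open>
  The induction removes a minimal branch \<open>C\<close> with boundary vertex \<open>v\<close> and adds \<open>v\<close> to the
  transversal of \<open>V - C\<close>. The equality case is carried along: from \<open>k * card X = card V\<close> follow
  \<open>card C = k\<close> and equality for \<open>V - C\<close>. The only component of \<open>V\<close> that is not yet one of \<open>V - C\<close>
  is the one containing \<open>C\<close>; it is either \<open>C\<close> itself or the join of a component of \<open>V - C\<close> and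
  the tree on \<open>C\<close> by the edge \<open>(w, v)\<close>. The empty transversal suffices once no connected set with
  \<open>k\<close> or more vertices is left, and equality then forces \<open>V\<close> to be empty.
\<close>

lemma exists_transversal:
  assumes G: "pair_graph G" "acyclic_graph G" and k: "k > 0" and V: "V \<subseteq> pverts G"
  shows "\<exists>X \<subseteq> V. (\<forall>U \<subseteq> V - X. connected_set (parcs G) U \<longrightarrow> card U \<noteq> k) \<and> k * card X \<le> card V \<and>
    (k * card X = card V \<longrightarrow> (\<forall>U. component (parcs G) V U \<longrightarrow>
       k dvd card U \<and> induced G U \<in> R_family k (card U div k)))"
  using V
proof (induction "card V" arbitrary: V rule: less_induct)
  case less
  interpret forest_relation "parcs G" using G by (rule forest_relation_parcs)
  let ?E = "parcs G"
  have finV: "finite V" using less.prems finite_pverts[OF G(1)] by (rule finite_subset)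
  show ?case
  proof (cases "\<exists>W \<subseteq> V. connected_set ?E W \<and> k \<le> card W")
    case False
    have "\<not> component ?E V U" if "card V = 0" for U
      using that finV by (auto simp: component_def connected_set_def)
    then show ?thesis using False by (intro exI[of _ "{}"]) auto
  next
    case True
    then obtain W where W: "W \<subseteq> V" "connected_set ?E W" "k \<le> card W" by blast
    obtain C v w where C: "connected_set ?E C" "C \<subseteq> V" "k \<le> card C" "v \<in> C"
      and out: "?E \<inter> C \<times> (V - C) \<subseteq> {(v, w)}"
      and small: "\<And>D. connected_set ?E D \<Longrightarrow> D \<subseteq> C - {v} \<Longrightarrow> card D < k"
      using exists_branch[OF finV W(2,1,3)] by blast
    have finC: "finite C" using C(2) finV by (rule finite_subset)
    have cardV: "card V = card (V - C) + card C"
      using C(2) finV finC by (simp add: card_Diff_subset card_mono)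
    have "card (V - C) < card V" using cardV C(3) k by linarith
    from less.hyps[OF this] less.prems
    have "\<exists>X \<subseteq> V - C. (\<forall>U \<subseteq> V - C - X. connected_set ?E U \<longrightarrow> card U \<noteq> k) \<and>
      k * card X \<le> card (V - C) \<and> (k * card X = card (V - C) \<longrightarrow>
        (\<forall>U. component ?E (V - C) U \<longrightarrow> k dvd card U \<and> induced G U \<in> R_family k (card U div k)))"
      by blast
    then obtain X where X: "X \<subseteq> V - C" "\<forall>U \<subseteq> V - C - X. connected_set ?E U \<longrightarrow> card U \<noteq> k"
      "k * card X \<le> card (V - C)"
      and dec: "k * card X = card (V - C) \<Longrightarrow> \<forall>U. component ?E (V - C) U \<longrightarrow>
         k dvd card U \<and> induced G U \<in> R_family k (card U div k)"
      by blast
    have finX: "finite X" and "v \<notin> X" using X(1) finV C(4) by (auto intro: finite_subset)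
    then have cardX: "k * card (insert v X) = k + k * card X" by simp
    show ?thesis
    proof (intro exI[of _ "insert v X"] conjI allI impI)
      show "insert v X \<subseteq> V" using X(1) C by blast
      show "k * card (insert v X) \<le> card V" using cardX X(3) C(3) cardV by linarith
      fix U
      {
        assume U: "U \<subseteq> V - insert v X" "connected_set ?E U"
        \<comment> \<open>A set on both sides of the boundary would need the edge at v, which is in the transversal.\<close>
        consider "U \<subseteq> C - {v}" | "U \<subseteq> V - C - X" | "U \<inter> C \<noteq> {}" "U - C \<noteq> {}" using U(1) by blast
        then show "card U \<noteq> k"
        proof cases
          case 1
          then show ?thesis using small U by blast
        next
          case 2
          then show ?thesis using X U by blast
        next
          case 3
          then obtain a b where "a \<in> U" "a \<in> C" "b \<in> U" "b \<notin> C" "(a, b) \<in> ?E"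
            using connected_set_crossing[OF U(2)] by blast
          then show ?thesis using out U by blast
        qed
      }
      assume "k * card (insert v X) = card V" and U: "component ?E V U"
      then have cardC: "card C = k" and eq: "k * card X = card (V - C)"
        using cardX X(3) C(3) cardV by linarith+
      note dec = dec[OF eq, rule_format]
      have UV: "U \<subseteq> V" "connected_set ?E U" using U by (auto simp: component_def)
      have treeC: "tree_graph (induced G C)" and treeU: "tree_graph (induced G U)"
        using C UV less.prems by (auto intro!: tree_graph_induced G)
      have "k dvd card U \<and> induced G U \<in> R_family k (card U div k)"
      proof (cases "U \<inter> C = {}")
        case True
        then have "component ?E (V - C) U" using U by (auto simp: component_def)
        then show ?thesis by (rule dec)
      next
        case False
        then have CU: "C \<subseteq> U" using component_absorbs[OF U C(1,2)] by blast
        show ?thesis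
        proof (cases "C = U")
          case True
          then show ?thesis using cardC treeC k by simp
        next
          case False
          with CU have "C \<subset> U" by blast
          then obtain a b where "a \<in> U" "a \<in> C" "b \<in> U" "b \<notin> C" "(a, b) \<in> ?E"
            using connected_set_crossing[OF UV(2), of C] C(4) by blast
          then have vw: "(v, w) \<in> ?E" "w \<in> U - C" using out UV by auto
          then have wv: "(w, v) \<in> ?E" using sym by (blast dest: symD)
          have U': "component ?E (V - C) (U - C)" using component_Diff_branch[OF U \<open>C \<subset> U\<close> out] .
          note IH = dec[OF U']
          have from_C: "x = v \<and> y = w" if "(x, y) \<in> ?E" "x \<in> C" "y \<in> U - C" for x y
            using that out UV(1) by blast
          have into_C: "x = w \<and> y = v" if "(x, y) \<in> ?E" "x \<in> U - C" "y \<in> C" for x y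
            using from_C[OF symD[OF sym that(1)]] that(2,3) by blast
          have "?E \<inter> U \<times> U = ?E \<inter> (U - C) \<times> (U - C) \<union> ?E \<inter> C \<times> C \<union> {(w, v), (v, w)}"
          proof (intro equalityI subrelI)
            fix x y assume xy: "(x, y) \<in> ?E \<inter> U \<times> U"
            then show "(x, y) \<in> ?E \<inter> (U - C) \<times> (U - C) \<union> ?E \<inter> C \<times> C \<union> {(w, v), (v, w)}"
              using from_C[of x y] into_C[of x y] by (cases "x \<in> C"; cases "y \<in> C") simp_all
          next
            fix x y assume "(x, y) \<in> ?E \<inter> (U - C) \<times> (U - C) \<union> ?E \<inter> C \<times> C \<union> {(w, v), (v, w)}"
            then show "(x, y) \<in> ?E \<inter> U \<times> U" using CU vw wv C(4) by blast
          qed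
          moreover have "U - C \<union> C = U" using CU by blast
          ultimately have join: "induced G U = join_by_edge (induced G (U - C)) (induced G C) w v"
            by (simp add: induced_def join_by_edge_def)
          have cardU: "card U = card (U - C) + k"
            using card_Diff_subset[OF finC CU] card_mono[OF finite_subset[OF UV(1) finV] CU] cardC
            by linarith
          \<comment> \<open>The value of the family at index 0 is empty, so membership excludes it.\<close>
          have "card (U - C) div k > 0"
            using IH vw(2) by (cases "card (U - C) div k") auto
          moreover have "card U div k = Suc (card (U - C) div k)" using cardU k by simp
          ultimately have "induced G U \<in> R_family k (card U div k)"
            using IH treeC treeU cardC vw(2) C(4) unfolding join
            by (auto intro!: R_family_join simp del: R_family.simps)
          then show ?thesis using IH cardU by simp
        qed
      qed
      then show "k dvd card U" "induced G U \<in> R_family k (card U div k)" by blast+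
    qed
  qed
qed

section \<open>Every member of the family needs a full transversal\<close>

lemma tree_not_filled:
  assumes "tree_graph T" "card (pverts T) = k" "parcs T \<subseteq> E"
    and "\<forall>U \<subseteq> S. connected_set E U \<longrightarrow> card U \<noteq> k"
  shows "k * card (S \<inter> pverts T) \<le> (k - 1) * k"
proof -
  have "connected_set E (pverts T)"
    using connected_set_mono[OF tree_graph_connected_set[OF assms(1)]] assms(3) by blast
  then have "S \<inter> pverts T \<noteq> pverts T" using assms(2,4) by blast
  then have "card (S \<inter> pverts T) < k"
    using assms(1,2) finite_pverts[of T] by (auto simp: tree_graph_def intro!: psubset_card_mono)
  then have "card (S \<inter> pverts T) \<le> k - 1" by linarith
  then show ?thesis by (simp add: mult.commute)
qed

text \<open>
  Each of the trees on \<open>k\<close> vertices joined together in the construction of \<open>T\<close> loses at least one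
  vertex. The bound is multiplied by \<open>k\<close> and refers to the number of vertices of \<open>T\<close>, so that it
  can be added up over components of different index.
\<close>

lemma R_family_independent_bound:
  assumes "T \<in> R_family k i" "parcs T \<subseteq> E"
    and "\<forall>U \<subseteq> S. connected_set E U \<longrightarrow> card U \<noteq> k"
  shows "k * card (S \<inter> pverts T) \<le> (k - 1) * card (pverts T)"
  using assms(1,2)
proof (induction i arbitrary: T)
  case 0
  then show ?case by simp
next
  case (Suc i)
  show ?case
  proof (cases i)
    case 0
    then have "tree_graph T" "card (pverts T) = k" using Suc.prems(1) by auto
    then show ?thesis using tree_not_filled[OF _ _ Suc.prems(2) assms(3)] by simp
  next
    case (Suc j)
    then obtain T' T'' u v where T: "tree_graph T" "T' \<in> R_family k i" "tree_graph T''"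
      "card (pverts T'') = k" "pverts T' \<inter> pverts T'' = {}" "T = join_by_edge T' T'' u v"
      using Suc.prems(1) by auto
    have V: "pverts T = pverts T' \<union> pverts T''" and E: "parcs T' \<subseteq> E" "parcs T'' \<subseteq> E"
      using T(6) Suc.prems(2) by (auto simp: join_by_edge_def)
    have fin: "finite (pverts T')" "finite (pverts T'')"
      using T(1) V finite_pverts[of T] by (auto simp: tree_graph_def)
    have "k * card (S \<inter> pverts T) = k * card (S \<inter> pverts T') + k * card (S \<inter> pverts T'')"
    proof -
      have "S \<inter> pverts T = S \<inter> pverts T' \<union> S \<inter> pverts T''" using V by blast
      moreover have "card (S \<inter> pverts T' \<union> S \<inter> pverts T'') = card (S \<inter> pverts T') + card (S \<inter> pverts T'')"
        using fin T(5) by (intro card_Un_disjoint) auto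
      ultimately show ?thesis by (simp add: distrib_left)
    qed
    also have "\<dots> \<le> (k - 1) * card (pverts T') + (k - 1) * k"
      using Suc.IH[OF T(2) E(1)] tree_not_filled[OF T(3,4) E(2) assms(3)] by linarith
    also have "\<dots> = (k - 1) * card (pverts T)"
      using V T(4) card_Un_disjoint[OF fin T(5)] by (simp add: distrib_left)
    finally show ?thesis .
  qed
qed

section \<open>The bound and its extremal forests\<close>

theorem theorem1p2:
  fixes F :: "'a pair_pre_digraph" and k n :: nat
  assumes "k \<ge> 2"
    and "pair_graph F" and "acyclic_graph F"
    and "card (pverts F) = n" and "n \<ge> k"
  shows "real (gen_independence_number k F) \<ge> (real k - 1) / real k * real n \<and>
    (real (gen_independence_number k F) = (real k - 1) / real k * real n \<longleftrightarrow>
      (\<forall>T \<in> graph_components F.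
         k dvd card (pverts T) \<and> T \<in> R_family k (card (pverts T) div k)))"
proof -
  let ?E = "parcs F" and ?V = "pverts F" and ?\<alpha> = "gen_independence_number k F"
  note F = assms(2,3)
  note comps = graph_components_eq[OF F(1)]
  have k: "k > 0" using assms(1) by simp
  obtain X where X: "X \<subseteq> ?V" "\<forall>U \<subseteq> ?V - X. connected_set ?E U \<longrightarrow> card U \<noteq> k" "k * card X \<le> n"
    and dec: "k * card X = n \<Longrightarrow> \<forall>U. component ?E ?V U \<longrightarrow>
      k dvd card U \<and> induced F U \<in> R_family k (card U div k)"
    using exists_transversal[OF F k order_refl] assms(4) by blast
  have indep: "gen_independent k F (?V - X)" using X gen_independent_iff[OF F] by blast
  have cardVX: "card (?V - X) = n - card X" "card X \<le> n"
    using X(1) assms(4) finite_pverts[OF F(1)]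
    by (auto simp: card_Diff_subset finite_subset intro: card_mono)
  have ge: "n \<le> ?\<alpha> + card X"
    using gen_independence_number_ge[OF F(1) indep] cardVX by linarith
  then have "k * n \<le> k * ?\<alpha> + k * card X" by (metis add_mult_distrib2 mult_le_mono2)
  then have lower: "k * n \<le> k * ?\<alpha> + n" and strict: "k * n = k * ?\<alpha> + n \<Longrightarrow> k * card X = n"
    using X(3) by linarith+
  have upper: "k * ?\<alpha> + n \<le> k * n"
    if R: "\<forall>T \<in> graph_components F. k dvd card (pverts T) \<and> T \<in> R_family k (card (pverts T) div k)"
  proof -
    obtain S where S: "gen_independent k F S" "?\<alpha> = card S"
      using gen_independence_number_attained[OF F(1) indep] .
    then have SV: "S \<subseteq> ?V" and none: "\<forall>U \<subseteq> S. connected_set ?E U \<longrightarrow> card U \<noteq> k"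
      using gen_independent_iff[OF F] by auto
    note sums = card_eq_sum_components[OF sym_parcs[OF F(1)] finite_pverts[OF F(1)]]
    have "k * card S = (\<Sum>U | component ?E ?V U. k * card (S \<inter> U))"
      using sums[OF SV] by (simp add: sum_distrib_left)
    also have "\<dots> \<le> (\<Sum>U | component ?E ?V U. (k - 1) * card (?V \<inter> U))"
    proof (rule sum_mono)
      fix U assume U: "U \<in> {U. component ?E ?V U}"
      then have "induced F U \<in> R_family k (card U div k)" using R comps by fastforce
      from R_family_independent_bound[OF this _ none]
      have "k * card (S \<inter> U) \<le> (k - 1) * card U" by simp
      moreover have "?V \<inter> U = U" using U by (auto simp: component_def)
      ultimately show "k * card (S \<inter> U) \<le> (k - 1) * card (?V \<inter> U)" by simp
    qed
    also have "\<dots> = (k - 1) * n"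
      using sums[OF order_refl] assms(4) by (simp add: sum_distrib_left)
    finally have "k * card S + n \<le> (k - 1) * n + n" by simp
    also have "(k - 1) * n + n = k * n" using k by (cases k) auto
    finally show ?thesis using S(2) by simp
  qed
  have iff: "k * n = k * ?\<alpha> + n \<longleftrightarrow>
    (\<forall>T \<in> graph_components F. k dvd card (pverts T) \<and> T \<in> R_family k (card (pverts T) div k))"
    (is "_ \<longleftrightarrow> ?R")
  proof
    assume "k * n = k * ?\<alpha> + n"
    from dec[OF strict[OF this]] show ?R by (simp add: comps)
  next
    assume ?R
    from lower upper[OF this] show "k * n = k * ?\<alpha> + n" by (rule order_antisym)
  qed
  \<comment> \<open>Both claims compare k * n with k times the independence number plus n.\<close>
  have "(real k - 1) / real k * real n \<le> real ?\<alpha> \<longleftrightarrow> real (k * n) \<le> real (k * ?\<alpha> + n)"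
    "real ?\<alpha> = (real k - 1) / real k * real n \<longleftrightarrow> real (k * n) = real (k * ?\<alpha> + n)"
    using k by (auto simp: field_simps)
  then show ?thesis using lower iff by (simp only: of_nat_le_iff of_nat_eq_iff)
qed

end
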